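(* Let $(X,\tau)$, $(Y,\tau')$, $(Z,\tau'')$ be compact Hausdorff spaces and let $d_0$ be a pseudo-metric on $X$ such that $\tau_{d_0}\subset\tau$. Let $F:Y\times Z\to X$ be a map that is continuous with respect to $\tau,\tau',\tau''$, and define a pseudo-metric $d_1$ on $Z$ by $$d_1(z,z')=\sup_{y\in Y}d_0(F(y,z),F(y,z')).$$ With the canonical identification $\mathbf{C}(Y\times Z,\tau'\times\tau'')\cong\mathbf{C}(Y,\tau')\otimes\mathbf{C}(Z,\tau'')$, let $\hat F:\mathbf{C}(X,\tau)\to\mathbf{C}(Y,\tau')\otimes\mathbf{C}(Z,\tau'')$ be defined by $\hat F(a)=a\circ F$ for $a\in\mathbf{C}(X,\tau)$. Let $(\mathbf{C}(Z,\tau''),\mathcal{C},N)$ be the QSM space induced by the QSM space $(\mathbf{C}(X,\tau),\mathbf{Lip}(X,d_0),\|\cdot\|_{d_0})$ and the quantum family of morphisms $(\mathbf{C}(Z,\tau''),\hat F)$. Then: (i) $d_1(z,z')=\rho_N(\delta_z,\delta_{z'})$ for every $z,z'\in Z$. (ii) $\mathcal{C}\subset\mathbf{Lip}(Z,d_1)$. (iii) $\|c\|_{d_1}\leq N(c)$ for every $c\in\mathcal{C}$.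
   Context: A pseudo-metric on a set $X$ is a nonnegative symmetric function $d$ on $X\times X$ satisfying the triangle inequality and $d(x,x)=0$ for all $x$; $\tau_d$ is the topology it induces. For a topological space $(X,\tau)$ (resp. pseudo-metric space $(X,d)$), $\mathbf{C}(X,\tau)$ (resp. $\mathbf{C}(X,d)$) is the C*-algebra of bounded continuous complex-valued functions on $X$ with the uniform norm. For $f\in\mathbf{C}(X,d)$, $$\|f\|_d=\sup\Big\{\frac{|f(x)-f(x')|}{d(x,x')}:\ x,x'\in X,\ d(x,x')\neq0\Big\}$$ and $\mathbf{Lip}(X,d)=\{f\in\mathbf{C}(X,d):\|f\|_d<\infty\}$. $\delta_x$ is the point evaluation (point mass) state at $x$. For a unital C*-algebra $\mathfrak{A}$, $S(\mathfrak{A})$ is its state space with the w* topology. $\otimes$ is the spatial tensor product. For a self-adjoint linear subspace $\mathcal{A}\subset\mathfrak{A}$ and a seminorm $L:\mathcal{A}\to[0,\infty)$, define on $S(\mathfrak{A})$ $$\rho_L(\mu,\nu)=\sup\{|\mu(a)-\nu(a)|:\ a\in\mathcal{A},\ L(a)\leq1\}.$$ For a pseudo-metric $d$ on $S(\mathfrak{A})$, define $L_d:\mathfrak{A}\to[0,+\infty]$ by $$L_d(a)=\sup\Big\{\frac{|\mu(a)-\nu(a)|}{d(\mu,\nu)}:\ \mu,\nu\in S(\mathfrak{A}),\ d(\mu,\nu)\neq0\Big\}$$ (suprema over the empty set are $0$). A compact quantum pseudo-metric space (QSM space) is a triple $(\mathfrak{A},\mathcal{A},L)$, where $\mathfrak{A}$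 is a unital C*-algebra, $\mathcal{A}$ is a self-adjoint linear subspace of $\mathfrak{A}$ with $1_{\mathfrak{A}}\in\mathcal{A}$, and $L:\mathcal{A}\to[0,+\infty)$ is a seminorm such that: (a) $L(a)=L(a^* )$ for all $a\in\mathcal{A}$; (b) $L(a)=0$ if and only if $a\in\mathbb{C}1_{\mathfrak{A}}$; (c) the topology induced by $\rho_L$ on $S(\mathfrak{A})$ is weaker than (contained in) the w* topology. When $\tau_{d_0}\subset\tau$ and $(X,\tau)$ is compact Hausdorff, $(\mathbf{C}(X,\tau),\mathbf{Lip}(X,d_0),\|\cdot\|_{d_0})$ is a QSM space. A quantum family of morphisms from $\mathfrak{A}$ to $\mathfrak{B}$ (unital C*-algebras) is a pair $(\mathfrak{C},\Phi)$ with $\mathfrak{C}$ a unital C*-algebra and $\Phi:\mathfrak{A}\to\mathfrak{B}\otimes\mathfrak{C}$ a unital *-homomorphism. Given a QSM space $(\mathfrak{A},\mathcal{A},L)$ and such a family, the induced QSM space is $(\mathfrak{C},\mathcal{C},L_d)$, where $d$ is the pseudo-metric on $S(\mathfrak{C})$ $$d(\nu,\nu')=\sup\{\rho_L((\mu\otimes\nu)\Phi,(\mu\otimes\nu')\Phi):\ \mu\in S(\mathfrak{B})\},$$ $\mathcal{C}$ is the space of all $c\in\mathfrak{C}$ such that $\nu\mapsto\nu(c)$ on $S(\mathfrak{C})$ is continuous for the topology induced by $d$ and $L_d(c)<\infty$, and $L_d$ is restricted to $\mathcal{C}$. In the claim, $\mathfrak{A}=\mathbf{C}(X,\tau)$,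 $\mathcal{A}=\mathbf{Lip}(X,d_0)$, $L=\|\cdot\|_{d_0}$, $\mathfrak{B}=\mathbf{C}(Y,\tau')$, $\mathfrak{C}=\mathbf{C}(Z,\tau'')$, $\Phi=\hat F$, and $N=L_d$ restricted to $\mathcal{C}$. *)

theory Defs
  imports "HOL-Analysis.Analysis"
begin

section \<open>Unital C*-algebras\<close>

class scaleC =
  fixes scaleC :: "complex \<Rightarrow> 'a \<Rightarrow> 'a"  (infixr "*\<^sub>C" 75)

class star =
  fixes star :: "'a \<Rightarrow> 'a"

text \<open>Since \<^class>\<open>real_normed_algebra_1\<close> demands \<open>norm 1 = 1\<close>, the zero algebra is excluded.\<close>

class unital_cstar_algebra = real_normed_algebra_1 + banach + scaleC + star +
  assumes scaleR_scaleC: "r *\<^sub>R a = complex_of_real r *\<^sub>C a"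
    and scaleC_add_right: "x *\<^sub>C (a + b) = x *\<^sub>C a + x *\<^sub>C b"
    and scaleC_add_left: "(x + y) *\<^sub>C a = x *\<^sub>C a + y *\<^sub>C a"
    and scaleC_scaleC: "x *\<^sub>C y *\<^sub>C a = (x * y) *\<^sub>C a"
    and scaleC_mult_left: "(x *\<^sub>C a) * b = x *\<^sub>C (a * b)"
    and scaleC_mult_right: "a * (x *\<^sub>C b) = x *\<^sub>C (a * b)"
    and norm_scaleC: "norm (x *\<^sub>C a) = cmod x * norm a"
    and star_add: "star (a + b) = star a + star b"
    and star_scaleC: "star (x *\<^sub>C a) = cnj x *\<^sub>C star a"
    and star_mult: "star (a * b) = star b * star a"
    and star_star: "star (star a) = a"
    and cstar_identity: "norm (star a * a) = (norm a)\<^sup>2"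

definition unital_star_hom :: "('a::unital_cstar_algebra \<Rightarrow> 'b::unital_cstar_algebra) \<Rightarrow> bool" where
  "unital_star_hom \<Phi> \<longleftrightarrow>
     (\<forall>a b. \<Phi> (a + b) = \<Phi> a + \<Phi> b) \<and> (\<forall>x a. \<Phi> (x *\<^sub>C a) = x *\<^sub>C \<Phi> a) \<and>
     (\<forall>a b. \<Phi> (a * b) = \<Phi> a * \<Phi> b) \<and> (\<forall>a. \<Phi> (star a) = star (\<Phi> a)) \<and> \<Phi> 1 = 1"

definition states :: "('a::unital_cstar_algebra \<Rightarrow> complex) set" where
  "states = {\<mu>. (\<forall>a b. \<mu> (a + b) = \<mu> a + \<mu> b) \<and> (\<forall>x a. \<mu> (x *\<^sub>C a) = x * \<mu> a) \<and>
     (\<forall>a. \<mu> (star a * a) \<in> \<real>\<^sub>\<ge>\<^sub>0) \<and> \<mu> 1 = 1}"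

definition weak_star_topology :: "('a::unital_cstar_algebra \<Rightarrow> complex) topology" where
  "weak_star_topology = subtopology (product_topology (\<lambda>_. euclidean) UNIV) states"

subsection \<open>The C*-algebra of bounded continuous functions\<close>

instantiation complex :: unital_cstar_algebra
begin

definition scaleC_complex :: "complex \<Rightarrow> complex \<Rightarrow> complex" where
  "scaleC_complex x a = x * a"

definition star_complex :: "complex \<Rightarrow> complex" where
  "star_complex = cnj"

instance
  by standard
    (auto simp: scaleC_complex_def star_complex_def scaleR_conv_of_real algebra_simps
      norm_mult power2_eq_square)

end

lemma mult_bcontfun:
  fixes f g :: "'a::topological_space \<Rightarrow>\<^sub>C 'b::real_normed_algebra"
  shows "(\<lambda>x. f x * g x) \<in> bcontfun"
proof (rule bcontfun_normI)
  show "continuous_on UNIV (\<lambda>x. f x * g x)"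
    by (intro continuous_intros) auto
  show "norm (f x * g x) \<le> norm f * norm g" for x
    by (rule order_trans[OF norm_mult_ineq]) (intro mult_mono norm_bounded norm_ge_zero)
qed

instantiation bcontfun :: (topological_space, real_normed_algebra_1) real_normed_algebra_1
begin

definition times_bcontfun :: "('a \<Rightarrow>\<^sub>C 'b) \<Rightarrow> ('a \<Rightarrow>\<^sub>C 'b) \<Rightarrow> ('a \<Rightarrow>\<^sub>C 'b)" where
  "times_bcontfun f g = Bcontfun (\<lambda>x. f x * g x)"

definition one_bcontfun :: "'a \<Rightarrow>\<^sub>C 'b" where
  "one_bcontfun = const_bcontfun 1"

lemma apply_times_bcontfun [simp]: "apply_bcontfun (f * g) x = f x * g x"
  by (simp add: times_bcontfun_def Bcontfun_inverse mult_bcontfun)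

lemma apply_one_bcontfun [simp]: "apply_bcontfun 1 x = 1"
  by (simp add: one_bcontfun_def)

instance
proof
  fix f g h :: "'a \<Rightarrow>\<^sub>C 'b" and r :: real
  show "f * g * h = f * (g * h)" "1 * f = f" "f * 1 = f"
    "(f + g) * h = f * h + g * h" "f * (g + h) = f * g + f * h"
    "r *\<^sub>R f * g = r *\<^sub>R (f * g)" "f * r *\<^sub>R g = r *\<^sub>R (f * g)"
    by (auto intro!: bcontfun_eqI simp: algebra_simps)
  show "(0::'a \<Rightarrow>\<^sub>C 'b) \<noteq> 1"
  proof
    assume "(0::'a \<Rightarrow>\<^sub>C 'b) = 1"
    then have "apply_bcontfun (0::'a \<Rightarrow>\<^sub>C 'b) undefined = apply_bcontfun 1 undefined" by simp
    then show False by simp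
  qed
  show "norm (f * g) \<le> norm f * norm g"
    by (rule norm_bound)
      (auto intro!: order_trans[OF norm_mult_ineq] mult_mono norm_bounded)
  show "norm (1::'a \<Rightarrow>\<^sub>C 'b) = 1"
  proof (rule antisym)
    show "norm (1::'a \<Rightarrow>\<^sub>C 'b) \<le> 1" by (rule norm_bound) simp
    show "1 \<le> norm (1::'a \<Rightarrow>\<^sub>C 'b)"
      using norm_bounded[of "1::'a \<Rightarrow>\<^sub>C 'b" undefined] by simp
  qed
qed

end

text \<open>The library provides this instance only for metric domains.\<close>

instance bcontfun :: (topological_space, complete_space) complete_space
proof
  fix f :: "nat \<Rightarrow> 'a \<Rightarrow>\<^sub>C 'b"
  assume "Cauchy f"
  then obtain g where "uniform_limit UNIV f g sequentially"
    using uniformly_convergent_eq_cauchy[of "\<lambda>_. True" f]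
    unfolding Cauchy_def uniform_limit_sequentially_iff
    by (metis dist_fun_lt_imp_dist_val_lt)
  from uniform_limit_bcontfunE[OF this sequentially_bot]
  obtain l where "g = apply_bcontfun l" "f \<longlonglongrightarrow> l" by metis
  then show "convergent f" by (intro convergentI)
qed

instance bcontfun :: (topological_space, "{real_normed_algebra_1, banach}") banach ..

lemma norm_star [simp]: "norm (star a) = norm (a::'a::unital_cstar_algebra)"
proof -
  have le: "norm b \<le> norm (star b)" for b :: 'a
  proof (cases "norm b = 0")
    case False
    have "norm b * norm b \<le> norm (star b) * norm b"
      using norm_mult_ineq[of "star b" b] by (simp add: cstar_identity power2_eq_square)
    with False show ?thesis by simp
  qed simp
  show ?thesis using le[of a] le[of "star a"] by (simp add: star_star)
qed

lemma star_diff: "star (a - b) = star a - star (b::'a::unital_cstar_algebra)"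
  using star_add[of "a - b" b] by (simp add: algebra_simps)

lemma continuous_on_star: "continuous_on A f \<Longrightarrow> continuous_on A (\<lambda>x. star (f x))"
  for f :: "'a::topological_space \<Rightarrow> 'b::unital_cstar_algebra"
proof -
  have "continuous_on UNIV (star :: 'b \<Rightarrow> 'b)"
    unfolding continuous_on_iff dist_norm star_diff[symmetric] norm_star by blast
  then show "continuous_on A f \<Longrightarrow> continuous_on A (\<lambda>x. star (f x))"
    by (rule continuous_on_compose2) auto
qed

lemma continuous_on_scaleC: "continuous_on A f \<Longrightarrow> continuous_on A (\<lambda>x. c *\<^sub>C f x)"
  for f :: "'a::topological_space \<Rightarrow> 'b::unital_cstar_algebra"
proof -
  have "bounded_linear (scaleC c :: 'b \<Rightarrow> 'b)"
    by (rule bounded_linear_intro[of _ "cmod c"])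
      (simp_all add: scaleC_add_right scaleR_scaleC scaleC_scaleC norm_scaleC mult.commute)
  then show "continuous_on A f \<Longrightarrow> continuous_on A (\<lambda>x. c *\<^sub>C f x)"
    by (rule bounded_linear.continuous_on)
qed

instantiation bcontfun :: (topological_space, unital_cstar_algebra) unital_cstar_algebra
begin

definition scaleC_bcontfun :: "complex \<Rightarrow> ('a \<Rightarrow>\<^sub>C 'b) \<Rightarrow> ('a \<Rightarrow>\<^sub>C 'b)" where
  "scaleC_bcontfun c f = Bcontfun (\<lambda>x. c *\<^sub>C f x)"

definition star_bcontfun :: "('a \<Rightarrow>\<^sub>C 'b) \<Rightarrow> ('a \<Rightarrow>\<^sub>C 'b)" where
  "star_bcontfun f = Bcontfun (\<lambda>x. star (f x))"

lemma apply_scaleC_bcontfun [simp]: "apply_bcontfun (c *\<^sub>C f) x = c *\<^sub>C f x"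
proof -
  have "(\<lambda>x. c *\<^sub>C f x) \<in> bcontfun"
    by (rule bcontfun_normI[where b = "cmod c * norm f"])
      (auto intro!: continuous_on_scaleC mult_left_mono norm_bounded simp: norm_scaleC)
  then show ?thesis by (simp add: scaleC_bcontfun_def Bcontfun_inverse)
qed

lemma apply_star_bcontfun [simp]: "apply_bcontfun (star f) x = star (f x)"
proof -
  have "(\<lambda>x. star (f x)) \<in> bcontfun"
    by (rule bcontfun_normI[where b = "norm f"])
      (auto intro!: continuous_on_star norm_bounded)
  then show ?thesis by (simp add: star_bcontfun_def Bcontfun_inverse)
qed

instance
proof
  fix f g :: "'a \<Rightarrow>\<^sub>C 'b" and x y :: complex and r :: real
  show "r *\<^sub>R f = complex_of_real r *\<^sub>C f" "x *\<^sub>C (f + g) = x *\<^sub>C f + x *\<^sub>C g"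
    "(x + y) *\<^sub>C f = x *\<^sub>C f + y *\<^sub>C f" "x *\<^sub>C y *\<^sub>C f = (x * y) *\<^sub>C f"
    "(x *\<^sub>C f) * g = x *\<^sub>C (f * g)" "f * (x *\<^sub>C g) = x *\<^sub>C (f * g)"
    "star (f + g) = star f + star g" "star (x *\<^sub>C f) = cnj x *\<^sub>C star f"
    "star (f * g) = star g * star f" "star (star f) = f"
    by (auto intro!: bcontfun_eqI simp: scaleR_scaleC scaleC_add_right scaleC_add_left
        scaleC_scaleC scaleC_mult_left scaleC_mult_right star_add star_scaleC star_mult star_star)
  show "norm (x *\<^sub>C f) = cmod x * norm f"
  proof (rule antisym)
    show "norm (x *\<^sub>C f) \<le> cmod x * norm f"
      by (rule norm_bound) (auto simp: norm_scaleC intro!: mult_left_mono norm_bounded)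
    show "cmod x * norm f \<le> norm (x *\<^sub>C f)"
    proof (cases "x = 0")
      case False
      have "norm f \<le> norm (x *\<^sub>C f) / cmod x"
      proof (rule norm_bound)
        fix t
        have "cmod x * norm (f t) \<le> norm (x *\<^sub>C f)"
          using norm_bounded[of "x *\<^sub>C f" t] by (simp add: norm_scaleC)
        then show "norm (f t) \<le> norm (x *\<^sub>C f) / cmod x"
          using False by (simp add: field_simps)
      qed
      then show ?thesis using False by (simp add: field_simps)
    qed simp
  qed
  show "norm (star f * f) = (norm f)\<^sup>2"
  proof (rule antisym)
    show "norm (star f * f) \<le> (norm f)\<^sup>2"
      by (rule norm_bound) (auto simp: cstar_identity intro!: power_mono norm_bounded)
    have "norm f \<le> sqrt (norm (star f * f))"
    proof (rule norm_bound)
      fix t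
      have "(norm (f t))\<^sup>2 \<le> norm (star f * f)"
        using norm_bounded[of "star f * f" t] by (simp add: cstar_identity)
      then show "norm (f t) \<le> sqrt (norm (star f * f))"
        by (rule real_le_rsqrt)
    qed
    then have "(norm f)\<^sup>2 \<le> (sqrt (norm (star f * f)))\<^sup>2"
      by (rule power_mono) simp
    then show "(norm f)\<^sup>2 \<le> norm (star f * f)" by simp
  qed
qed

end

definition point_eval :: "'x \<Rightarrow> ('x::topological_space \<Rightarrow>\<^sub>C complex) \<Rightarrow> complex"  ("\<delta>") where
  "\<delta> x = (\<lambda>f. f x)"

lemma point_eval_in_states: "\<delta> x \<in> states"
  by (auto simp: states_def point_eval_def scaleC_complex_def star_complex_def
      complex_nonneg_Reals_iff)

section \<open>Pseudo-metrics and Lipschitz functions\<close>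

text \<open>
  Pseudo-metrics and (semi)norm-like suprema take values in \<^typ>\<open>ennreal\<close>, where suprema
  always exist, the supremum of the empty set is \<open>0\<close>, and nonnegativity is built in.
  That a pseudo-metric is a genuine \<open>[0,\<infinity>)\<close>-valued function is part of the predicate below.
\<close>

definition pseudo_metric_on :: "'a set \<Rightarrow> ('a \<Rightarrow> 'a \<Rightarrow> ennreal) \<Rightarrow> bool" where
  "pseudo_metric_on S d \<longleftrightarrow>
     (\<forall>x\<in>S. \<forall>y\<in>S. d x y \<noteq> top \<and> d x y = d y x) \<and> (\<forall>x\<in>S. d x x = 0) \<and>
     (\<forall>x\<in>S. \<forall>y\<in>S. \<forall>z\<in>S. d x z \<le> d x y + d y z)"

definition pseudo_metric_topology :: "'a set \<Rightarrow> ('a \<Rightarrow> 'a \<Rightarrow> ennreal) \<Rightarrow> 'a topology" where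
  "pseudo_metric_topology S d =
     topology (\<lambda>U. U \<subseteq> S \<and> (\<forall>x\<in>U. \<exists>e>0. \<forall>y\<in>S. d x y < e \<longrightarrow> y \<in> U))"

lemma openin_pseudo_metric_topology:
  "openin (pseudo_metric_topology S d) U \<longleftrightarrow>
     U \<subseteq> S \<and> (\<forall>x\<in>U. \<exists>e>0. \<forall>y\<in>S. d x y < e \<longrightarrow> y \<in> U)"
proof -
  let ?P = "\<lambda>U. U \<subseteq> S \<and> (\<forall>x\<in>U. \<exists>e>0. \<forall>y\<in>S. d x y < e \<longrightarrow> y \<in> U)"
  have "istopology ?P"
    unfolding istopology_def
  proof (intro conjI allI impI)
    fix U V assume U: "?P U" and V: "?P V"
    show "U \<inter> V \<subseteq> S" using U by blast
    show "\<forall>x\<in>U \<inter> V. \<exists>e>0. \<forall>y\<in>S. d x y < e \<longrightarrow> y \<in> U \<inter> V"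
    proof
      fix x assume "x \<in> U \<inter> V"
      then obtain e e' where "e > 0" "\<forall>y\<in>S. d x y < e \<longrightarrow> y \<in> U"
        and "e' > 0" "\<forall>y\<in>S. d x y < e' \<longrightarrow> y \<in> V"
        using U V by blast
      then show "\<exists>e>0. \<forall>y\<in>S. d x y < e \<longrightarrow> y \<in> U \<inter> V"
        by (intro exI[of _ "min e e'"]) auto
    qed
  next
    fix K assume K: "\<forall>U\<in>K. ?P U"
    then show "\<Union>K \<subseteq> S" by blast
    show "\<forall>x\<in>\<Union>K. \<exists>e>0. \<forall>y\<in>S. d x y < e \<longrightarrow> y \<in> \<Union>K"
    proof
      fix x assume "x \<in> \<Union>K"
      then obtain U where "U \<in> K" "x \<in> U" by blast
      with K obtain e where "e > 0" "\<forall>y\<in>S. d x y < e \<longrightarrow> y \<in> U" by blast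
      with \<open>U \<in> K\<close> show "\<exists>e>0. \<forall>y\<in>S. d x y < e \<longrightarrow> y \<in> \<Union>K" by blast
    qed
  qed
  then show ?thesis
    by (simp add: pseudo_metric_topology_def topology_inverse')
qed

lemma topspace_pseudo_metric_topology [simp]: "topspace (pseudo_metric_topology S d) = S"
proof -
  have "openin (pseudo_metric_topology S d) S"
    by (auto simp: openin_pseudo_metric_topology intro: exI[of _ "1::ennreal"])
  then show ?thesis
    by (auto simp: topspace_def openin_pseudo_metric_topology)
qed

definition lip_seminorm :: "'a set \<Rightarrow> ('a \<Rightarrow> 'a \<Rightarrow> ennreal) \<Rightarrow> ('a \<Rightarrow> complex) \<Rightarrow> ennreal" where
  "lip_seminorm S d f =
     Sup {ennreal (cmod (f x - f x')) / d x x' | x x'. x \<in> S \<and> x' \<in> S \<and> d x x' \<noteq> 0}"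

definition Lip :: "'a set \<Rightarrow> ('a \<Rightarrow> 'a \<Rightarrow> ennreal) \<Rightarrow> ('a \<Rightarrow> complex) set" where
  "Lip S d = {f. continuous_map (pseudo_metric_topology S d) euclidean f \<and>
     bounded (f ` S) \<and> lip_seminorm S d f < top}"

section \<open>Compact quantum pseudo-metric spaces\<close>

definition rho :: "'a set \<Rightarrow> ('a \<Rightarrow> ennreal) \<Rightarrow> ('a \<Rightarrow> complex) \<Rightarrow> ('a \<Rightarrow> complex) \<Rightarrow> ennreal" where
  "rho A L \<mu> \<nu> = Sup {ennreal (cmod (\<mu> a - \<nu> a)) | a. a \<in> A \<and> L a \<le> 1}"

text \<open>
  A QSM space over the C*-algebra given by the type \<^typ>\<open>'a\<close> is a pair of a subspace and a
  seminorm; the values of the seminorm outside of the subspace are irrelevant.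
\<close>

definition QSM_space :: "'a::unital_cstar_algebra set \<times> ('a \<Rightarrow> ennreal) \<Rightarrow> bool" where
  "QSM_space = (\<lambda>(A, L).
     (\<forall>a\<in>A. \<forall>b\<in>A. a + b \<in> A) \<and> (\<forall>x. \<forall>a\<in>A. x *\<^sub>C a \<in> A) \<and> (\<forall>a\<in>A. star a \<in> A) \<and> 1 \<in> A \<and>
     (\<forall>a\<in>A. L a < top) \<and> (\<forall>a\<in>A. \<forall>b\<in>A. L (a + b) \<le> L a + L b) \<and>
     (\<forall>x. \<forall>a\<in>A. L (x *\<^sub>C a) = ennreal (cmod x) * L a) \<and>
     (\<forall>a\<in>A. L (star a) = L a) \<and>
     (\<forall>a\<in>A. L a = 0 \<longleftrightarrow> (\<exists>x. a = x *\<^sub>C 1)) \<and>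
     (\<forall>U. openin (pseudo_metric_topology states (rho A L)) U \<longrightarrow> openin weak_star_topology U))"

definition state_lip_seminorm ::
    "(('a::unital_cstar_algebra \<Rightarrow> complex) \<Rightarrow> ('a \<Rightarrow> complex) \<Rightarrow> ennreal) \<Rightarrow> 'a \<Rightarrow> ennreal" where
  "state_lip_seminorm d a = lip_seminorm states d (\<lambda>\<mu>. \<mu> a)"

text \<open>
  In the following definitions a concrete realization of the spatial tensor product of the
  algebras \<^typ>\<open>'b\<close> and \<^typ>\<open>'c\<close> is given by a C*-algebra \<^typ>\<open>'t\<close> together with the map
  \<open>tensor\<close> sending \<open>b\<close> and \<open>c\<close> to the elementary tensor of \<open>b\<close> and \<open>c\<close>.
\<close>

definition product_state ::
    "('b::unital_cstar_algebra \<Rightarrow> 'c::unital_cstar_algebra \<Rightarrow> 't::unital_cstar_algebra) \<Rightarrow>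
     ('b \<Rightarrow> complex) \<Rightarrow> ('c \<Rightarrow> complex) \<Rightarrow> 't \<Rightarrow> complex" where
  "product_state tensor \<mu> \<nu> = (THE \<omega>. \<omega> \<in> states \<and> (\<forall>b c. \<omega> (tensor b c) = \<mu> b * \<nu> c))"

definition induced_pseudo_metric ::
    "('b::unital_cstar_algebra \<Rightarrow> 'c::unital_cstar_algebra \<Rightarrow> 't::unital_cstar_algebra) \<Rightarrow>
     'a::unital_cstar_algebra set \<times> ('a \<Rightarrow> ennreal) \<Rightarrow> ('a \<Rightarrow> 't) \<Rightarrow>
     ('c \<Rightarrow> complex) \<Rightarrow> ('c \<Rightarrow> complex) \<Rightarrow> ennreal" where
  "induced_pseudo_metric tensor = (\<lambda>(A, L) \<Phi> \<nu> \<nu>'.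
     SUP \<mu>\<in>states. rho A L (product_state tensor \<mu> \<nu> \<circ> \<Phi>) (product_state tensor \<mu> \<nu>' \<circ> \<Phi>))"

definition induced_QSM_space ::
    "('b::unital_cstar_algebra \<Rightarrow> 'c::unital_cstar_algebra \<Rightarrow> 't::unital_cstar_algebra) \<Rightarrow>
     'a::unital_cstar_algebra set \<times> ('a \<Rightarrow> ennreal) \<Rightarrow> ('a \<Rightarrow> 't) \<Rightarrow>
     'c set \<times> ('c \<Rightarrow> ennreal)" where
  "induced_QSM_space tensor AL \<Phi> =
    (let d = induced_pseudo_metric tensor AL \<Phi> in
     ({c. continuous_map (pseudo_metric_topology states d) euclidean (\<lambda>\<nu>. \<nu> c) \<and>
          state_lip_seminorm d c < top},
      state_lip_seminorm d))"

section \<open>The commutative case\<close>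

definition Lip_QSM_space ::
    "('x \<Rightarrow> 'x \<Rightarrow> ennreal) \<Rightarrow>
     ('x::topological_space \<Rightarrow>\<^sub>C complex) set \<times> (('x \<Rightarrow>\<^sub>C complex) \<Rightarrow> ennreal)" where
  "Lip_QSM_space d =
     ({f. apply_bcontfun f \<in> Lip UNIV d}, \<lambda>f. lip_seminorm UNIV d (apply_bcontfun f))"

text \<open>If the topology of \<open>d\<close> is weaker than the given one, no Lipschitz function is lost.\<close>

lemma Lip_eq_image_Lip_QSM_space:
  fixes d :: "'x::topological_space \<Rightarrow> 'x \<Rightarrow> ennreal"
  assumes "\<And>U. openin (pseudo_metric_topology UNIV d) U \<Longrightarrow> open U"
  shows "Lip UNIV d = apply_bcontfun ` fst (Lip_QSM_space d)"
proof -
  have "f \<in> range apply_bcontfun" if f: "f \<in> Lip UNIV d" for f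
  proof -
    have "open (f -` V)" if "open V" for V
      using f that assms openin_continuous_map_preimage[of "pseudo_metric_topology UNIV d" euclidean f V]
      by (auto simp: Lip_def vimage_def)
    then have "f \<in> bcontfun"
      using f by (auto simp: bcontfun_def Lip_def continuous_on_open_vimage)
    then show ?thesis by (metis bcontfunE rangeI)
  qed
  then show ?thesis by (auto simp: Lip_QSM_space_def)
qed

text \<open>
  Under the canonical identification, for compact Hausdorff spaces, of the tensor product of
  the two function algebras with the functions on the product space, the elementary
  tensor of \<open>f\<close> and \<open>g\<close> is the function \<open>(y, z) \<mapsto> f y * g z\<close>.
\<close>

definition fun_tensor ::
    "('y::topological_space \<Rightarrow>\<^sub>C complex) \<Rightarrow> ('z::topological_space \<Rightarrow>\<^sub>C complex) \<Rightarrow>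
     (('y \<times> 'z) \<Rightarrow>\<^sub>C complex)" where
  "fun_tensor f g = Bcontfun (\<lambda>(y, z). f y * g z)"

lemma apply_fun_tensor [simp]: "apply_bcontfun (fun_tensor f g) (y, z) = f y * g z"
proof -
  have "(\<lambda>p. f (fst p) * g (snd p)) \<in> bcontfun"
  proof (rule bcontfun_normI[where b = "norm f * norm g"])
    show "continuous_on UNIV (\<lambda>p. f (fst p) * g (snd p))"
      by (intro continuous_on_mult continuous_on_compose2[of UNIV f _ fst]
          continuous_on_compose2[of UNIV g _ snd] continuous_on_fst continuous_on_snd
          continuous_on_id continuous_on_apply_bcontfun subset_UNIV)
    show "norm (f (fst p) * g (snd p)) \<le> norm f * norm g" for p
      by (auto simp: norm_mult intro!: mult_mono norm_bounded)
  qed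
  then show ?thesis by (simp add: fun_tensor_def Bcontfun_inverse case_prod_beta')
qed

definition pullback ::
    "('p::topological_space \<Rightarrow> 'x::topological_space) \<Rightarrow> ('x \<Rightarrow>\<^sub>C complex) \<Rightarrow> ('p \<Rightarrow>\<^sub>C complex)" where
  "pullback F a = Bcontfun (a \<circ> F)"

lemma apply_pullback:
  assumes "continuous_on UNIV F"
  shows "apply_bcontfun (pullback F a) p = a (F p)"
proof -
  have "a \<circ> F \<in> bcontfun"
    by (rule bcontfun_normI[where b = "norm a"])
      (auto intro!: continuous_on_compose2[OF _ assms] norm_bounded)
  then show ?thesis by (simp add: pullback_def Bcontfun_inverse)
qed

lemma unital_star_hom_pullback:
  "continuous_on UNIV F \<Longrightarrow> unital_star_hom (pullback F)"
  by (auto simp: unital_star_hom_def apply_pullback intro!: bcontfun_eqI)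

lemma pseudo_metric_on_SUP:
  fixes d :: "'x::topological_space \<Rightarrow> 'x \<Rightarrow> ennreal" and F :: "'y \<times> 'z \<Rightarrow> 'x"
  assumes X: "compact (UNIV :: 'x set)" and d: "pseudo_metric_on UNIV d"
    and weaker: "\<And>U. openin (pseudo_metric_topology UNIV d) U \<Longrightarrow> open U"
  shows "pseudo_metric_on UNIV (\<lambda>z z'. SUP y. d (F (y, z)) (F (y, z')))"
proof -
  have sym: "d x y = d y x" and d_refl: "d x x = 0" and tri: "d x z \<le> d x y + d y z"
    and fin: "d x y < top" for x y z
    using d by (auto simp: pseudo_metric_on_def less_top)
  define p :: 'x where "p = undefined"
  let ?B = "\<lambda>n::nat. {x. d p x < of_nat n}"
  have "open (?B n)" for n
  proof (rule weaker, unfold openin_pseudo_metric_topology, intro conjI ballI)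
    fix x assume "x \<in> ?B n"
    then have "d p x < of_nat n" by simp
    show "\<exists>e>0. \<forall>y\<in>UNIV. d x y < e \<longrightarrow> y \<in> ?B n"
    proof (intro exI[of _ "of_nat n - d p x"] conjI ballI impI)
      show "0 < of_nat n - d p x"
        using \<open>d p x < of_nat n\<close> fin[of p x] by (subst less_diff_eq_ennreal) auto
      fix y assume "d x y < of_nat n - d p x"
      then have "d p x + d x y < of_nat n"
        using fin[of p x] by (subst (asm) less_diff_eq_ennreal) (auto simp: add.commute)
      then show "y \<in> ?B n" using le_less_trans[OF tri[of p y x]] by simp
    qed
  qed simp
  moreover have "UNIV \<subseteq> (\<Union>n. ?B n)"
  proof
    fix x
    have "\<exists>n. d p x < of_nat n"
      using fin[of p x] by (rule ennreal_Ex_less_of_nat)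
    then show "x \<in> (\<Union>n. ?B n)" by simp
  qed
  ultimately obtain N where "finite N" and N: "UNIV \<subseteq> (\<Union>n\<in>N. ?B n)"
    by (rule compactE_image[OF X, of UNIV ?B])
  define m where "m = Max N"
  have le_m: "d p x \<le> of_nat m" for x
  proof -
    have "x \<in> (\<Union>n\<in>N. ?B n)" using N by (rule subsetD) simp
    then obtain n where "n \<in> N" and n: "d p x < of_nat n" by auto
    then have "n \<le> m" using \<open>finite N\<close> by (simp add: m_def)
    then have "of_nat n \<le> (of_nat m :: ennreal)" by (rule of_nat_mono)
    then show ?thesis by (rule order_trans[OF less_imp_le[OF n]])
  qed
  have bound: "d p x + d p y \<le> of_nat m + of_nat m" for x y
    by (rule add_mono[OF le_m le_m])
  have "d x y \<le> of_nat m + of_nat m" for x y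
    by (rule order_trans[OF tri[of x y p]]) (use bound[of x y] sym[of x p] in simp)
  then have "(SUP y. d (F (y, z)) (F (y, z'))) \<le> of_nat m + of_nat m" for z z'
    by (rule SUP_least)
  moreover have "of_nat m + of_nat m < (top::ennreal)"
    by (simp add: of_nat_less_top)
  ultimately have "(SUP y. d (F (y, z)) (F (y, z'))) \<noteq> top" for z z'
    by (metis le_less_trans less_irrefl)
  moreover have "(SUP y. d (F (y, z)) (F (y, z'))) = (SUP y. d (F (y, z')) (F (y, z)))" for z z'
    by (rule SUP_cong[OF HOL.refl sym])
  moreover have "(SUP y. d (F (y, z)) (F (y, z))) = 0" for z
    by (simp add: d_refl)
  moreover have "(SUP y. d (F (y, u)) (F (y, w)))
      \<le> (SUP y. d (F (y, u)) (F (y, v))) + (SUP y. d (F (y, v)) (F (y, w)))" for u v w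
    by (rule SUP_least, rule order_trans[OF tri add_mono]) (auto intro: SUP_upper)
  ultimately show ?thesis
    unfolding pseudo_metric_on_def by (intro conjI ballI)
qed

end

theory Submission
  imports Defs
begin

text \<open>
  Write \<open>d\<close> for the pseudo-metric that the quantum family induces on the states of the
  algebra \<open>C(Z)\<close>. Everything rests on two facts about \<open>d\<close>.

  First, \<open>z \<mapsto> \<delta> z\<close> is an isometry from \<open>(Z, d1)\<close> to \<open>(states, d)\<close>
  (\<open>induced_pseudo_metric_point_eval\<close>). Taking for \<open>\<mu>\<close> the point mass at \<open>y\<close> compares
  \<open>F (y, z)\<close> with \<open>F (y, z')\<close>, and for the Lipschitz seminorm the distance of two point masses
  is the distance of the points, so \<open>d\<close> is at least \<open>d1\<close>. Conversely, a state \<open>\<mu>\<close> of \<open>C(Y)\<close> is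
  contractive, so replacing point masses by arbitrary \<open>\<mu>\<close> does not enlarge the supremum.
  Consequently a function in \<open>C\<close>, which is continuous and Lipschitz on all states, restricts
  along this isometry to a continuous Lipschitz function on \<open>Z\<close>, with no larger constant; this
  yields the inclusion, the inequality between the seminorms, and \<open>rho C N \<le> d1\<close> on points.

  Second, if \<open>a\<close> has Lipschitz seminorm at most one, then for each \<open>y\<close> the slice
  \<open>z \<mapsto> a (F (y, z))\<close> lies in \<open>C\<close> and has seminorm at most one
  (\<open>cmod_diff_slice_le_induced_pseudo_metric\<close>), because evaluating a state \<open>\<nu>\<close> on it is
  evaluating the product of \<open>\<delta> y\<close> and \<open>\<nu>\<close> on \<open>a \<circ> F\<close>. Since
  \<open>d1 z z'\<close> is the supremum of the differences between the values of such slices at \<open>z\<close> and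
  \<open>z'\<close>, this gives \<open>d1 \<le> rho C N\<close> on points.

  In both facts one factor of each product state is a point mass. Such a product has an explicit
  form: restrict the function to a slice of \<open>Y \<times> Z\<close>, then apply the other state. That this
  functional is the only state with the prescribed values on elementary tensors
  (\<open>states_eq_if_eq_on_tensors\<close>) follows from the theorem of Stone and Weierstrass and the
  contractivity of states.
\<close>

section \<open>Lipschitz functions for a pseudo-metric\<close>

lemma continuous_map_pseudo_metric_eqI:
  fixes f :: "'a \<Rightarrow> complex"
  assumes f: "continuous_map (pseudo_metric_topology S d) euclidean f"
    and x: "x \<in> S" "x' \<in> S" and "d x x' = 0"
  shows "f x = f x'"
proof (rule ccontr)
  assume neq: "f x \<noteq> f x'"
  let ?U = "{w \<in> S. f w \<in> - {f x'}}"
  have "openin (pseudo_metric_topology S d) ?U"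
    using openin_continuous_map_preimage[OF f, of "- {f x'}"]
    by (simp only: topspace_pseudo_metric_topology open_openin[symmetric] open_Compl closed_singleton)
  moreover have "x \<in> ?U" using neq x by simp
  ultimately obtain e where "e > 0" "\<forall>y\<in>S. d x y < e \<longrightarrow> y \<in> ?U"
    unfolding openin_pseudo_metric_topology by blast
  with x \<open>d x x' = 0\<close> show False by auto
qed

text \<open>
  The supremum that defines the seminorm ignores pairs at distance zero; on these, continuity for
  the topology of \<open>d\<close> is what forces \<open>f\<close> to take equal values.
\<close>

lemma cmod_diff_le_of_lip_seminorm_le_1:
  assumes f: "continuous_map (pseudo_metric_topology S d) euclidean f"
    and L: "lip_seminorm S d f \<le> 1" and x: "x \<in> S" "x' \<in> S"
  shows "ennreal (cmod (f x - f x')) \<le> d x x'"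
proof (cases "d x x' = 0")
  case True
  then show ?thesis using continuous_map_pseudo_metric_eqI[OF f x] by simp
next
  case False
  have "ennreal (cmod (f x - f x')) / d x x' \<le> lip_seminorm S d f"
    unfolding lip_seminorm_def using x False by (intro Sup_upper) blast
  then have "ennreal (cmod (f x - f x')) / d x x' \<le> 1" using L by (rule order_trans)
  then show ?thesis
    using False
    by (cases "d x x'") (auto simp: divide_ennreal simp flip: ennreal_1)
qed

lemma lip_seminorm_le_1I:
  assumes "\<And>x x'. x \<in> S \<Longrightarrow> x' \<in> S \<Longrightarrow> ennreal (cmod (f x - f x')) \<le> d x x'"
  shows "lip_seminorm S d f \<le> 1"
  unfolding lip_seminorm_def
proof (rule Sup_least, clarify)
  fix x x' assume "x \<in> S" "x' \<in> S" "d x x' \<noteq> 0"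
  then show "ennreal (cmod (f x - f x')) / d x x' \<le> 1"
    using assms[of x x'] by (intro divide_le_posI_ennreal) (auto simp: zero_less_iff_neq_zero)
qed

lemma continuous_map_pseudo_metricI:
  fixes f :: "'a \<Rightarrow> complex"
  assumes "\<And>x x'. x \<in> S \<Longrightarrow> x' \<in> S \<Longrightarrow> ennreal (cmod (f x - f x')) \<le> d x x'"
  shows "continuous_map (pseudo_metric_topology S d) euclidean f"
proof (clarsimp simp: continuous_map_def openin_pseudo_metric_topology)
  fix V x assume "open V" "x \<in> S" "f x \<in> V"
  then obtain e where "e > 0" and e: "\<And>w. dist w (f x) < e \<Longrightarrow> w \<in> V"
    by (meson open_dist)
  have "f y \<in> V" if "y \<in> S" "d x y < ennreal e" for y
  proof (rule e)
    have "ennreal (cmod (f x - f y)) < ennreal e"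
      using assms[OF \<open>x \<in> S\<close> that(1)] that(2) by (rule le_less_trans)
    then show "dist (f y) (f x) < e"
      by (simp add: dist_norm norm_minus_commute ennreal_less_iff)
  qed
  then show "\<exists>e>0. \<forall>y\<in>S. d x y < e \<longrightarrow> f y \<in> V"
    using \<open>e > 0\<close> by (intro exI[of _ "ennreal e"]) auto
qed

lemma cmod_enn2real_diff_le:
  assumes d: "pseudo_metric_on UNIV d"
  shows "ennreal (cmod (complex_of_real (enn2real (d x y)) - complex_of_real (enn2real (d x y'))))
    \<le> d y y'"
proof -
  obtain r where r: "\<And>u v. 0 \<le> r u v" "\<And>u v. d u v = ennreal (r u v)"
  proof
    show "0 \<le> enn2real (d u v)" "d u v = ennreal (enn2real (d u v))" for u v
      using d by (auto simp: pseudo_metric_on_def less_top)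
  qed
  have "d x y \<le> d x y' + d y' y" "d x y' \<le> d x y + d y y'" "d y y' = d y' y"
    using d unfolding pseudo_metric_on_def by blast+
  then have "\<bar>r x y - r x y'\<bar> \<le> r y y'"
    using r by (auto simp flip: ennreal_plus)
  then show ?thesis
    using r by (simp add: ennreal_leI flip: of_real_diff)
qed

text \<open>
  The supremum is attained at the distance function \<open>d x\<close>, which is Lipschitz with constant
  one by the triangle inequality and bounded by compactness.
\<close>

lemma rho_Lip_point_eval:
  fixes d :: "'x::topological_space \<Rightarrow> 'x \<Rightarrow> ennreal"
  assumes X: "compact (UNIV :: 'x set)" and d: "pseudo_metric_on UNIV d"
    and weaker: "\<And>U. openin (pseudo_metric_topology UNIV d) U \<Longrightarrow> open U"
    and AL: "(A, L) = Lip_QSM_space d"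
  shows "rho A L (\<delta> x) (\<delta> x') = d x x'"
proof (rule antisym)
  show "rho A L (\<delta> x) (\<delta> x') \<le> d x x'"
    using AL unfolding rho_def
    by (auto simp: Lip_QSM_space_def Lip_def point_eval_def
        intro!: Sup_least cmod_diff_le_of_lip_seminorm_le_1)
  define f where "f y = complex_of_real (enn2real (d x y))" for y
  have lip: "ennreal (cmod (f y - f y')) \<le> d y y'" for y y'
    unfolding f_def by (rule cmod_enn2real_diff_le[OF d])
  have top: "continuous_map (pseudo_metric_topology UNIV d) euclidean f"
    by (rule continuous_map_pseudo_metricI) (rule lip)
  have "continuous_on UNIV f"
    using openin_continuous_map_preimage[OF top] weaker
    by (auto simp: continuous_on_open_vimage vimage_def)
  then have "bounded (f ` UNIV)"
    using X compact_continuous_image compact_imp_bounded by blast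
  moreover have L1: "lip_seminorm UNIV d f \<le> 1"
    by (rule lip_seminorm_le_1I) (rule lip)
  moreover from L1 have "lip_seminorm UNIV d f < top"
    by (rule le_less_trans) simp
  ultimately have "f \<in> Lip UNIV d" using top by (simp add: Lip_def)
  then obtain a where a: "a \<in> A" "f = apply_bcontfun a"
    using Lip_eq_image_Lip_QSM_space[OF weaker] AL by (metis fst_conv image_iff)
  have "ennreal (cmod (\<delta> x a - \<delta> x' a)) \<le> rho A L (\<delta> x) (\<delta> x')"
    unfolding rho_def using a L1 AL by (intro Sup_upper) (auto simp: Lip_QSM_space_def)
  moreover have "d x x = 0" "d x x' \<noteq> top" using d by (auto simp: pseudo_metric_on_def)
  then have "ennreal (cmod (\<delta> x a - \<delta> x' a)) = d x x'"
    unfolding point_eval_def a(2)[symmetric] by (simp add: f_def less_top)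
  ultimately show "d x x' \<le> rho A L (\<delta> x) (\<delta> x')" by simp
qed

section \<open>States of algebras of continuous functions\<close>

lemma star_one: "star 1 = (1 :: 'a::unital_cstar_algebra)"
  by (metis mult_1_right star_mult star_star)

lemma statesD:
  assumes "\<mu> \<in> states"
  shows "\<mu> (a + b) = \<mu> a + \<mu> b" "\<mu> (x *\<^sub>C a) = x * \<mu> a" "\<mu> (star a * a) \<in> \<real>\<^sub>\<ge>\<^sub>0" "\<mu> 1 = 1"
  using assms by (auto simp: states_def)

lemma state_diff:
  assumes "\<mu> \<in> states"
  shows "\<mu> (a - b) = \<mu> a - \<mu> b"
  using statesD(1)[OF assms, of "a - b" b] by simp

text \<open>
  Polarization: positivity on \<open>a + 1\<close> and on \<open>a + \<i> 1\<close> makes \<open>\<mu> (star a) + \<mu> a\<close>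
  and \<open>\<i> (\<mu> (star a) - \<mu> a)\<close> real.
\<close>

lemma state_star:
  assumes \<mu>: "\<mu> \<in> states"
  shows "\<mu> (star a) = cnj (\<mu> a)"
proof -
  have expand: "star (a + t *\<^sub>C 1) * (a + t *\<^sub>C 1)
      = star a * a + t *\<^sub>C star a + cnj t *\<^sub>C a + (cnj t * t) *\<^sub>C 1" for t
    by (simp add: star_add star_scaleC star_one distrib_left distrib_right scaleC_mult_left
        scaleC_mult_right scaleC_scaleC scaleC_add_right mult.commute)
  have "\<mu> (star a * a) + t * \<mu> (star a) + cnj t * \<mu> a + cnj t * t \<in> \<real>\<^sub>\<ge>\<^sub>0" for t
    using statesD(3)[OF \<mu>, of "a + t *\<^sub>C 1"] unfolding expand by (simp add: statesD[OF \<mu>])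
  from this[of 1] this[of \<i>] statesD(3)[OF \<mu>, of a] show ?thesis
    by (auto simp: complex_nonneg_Reals_iff complex_eq_iff)
qed

text \<open>
  The square root of a nonnegative bounded continuous function is again one, so \<open>f\<close> has the
  form \<open>star k * k\<close>.
\<close>

lemma state_nonneg:
  fixes f :: "'k::topological_space \<Rightarrow>\<^sub>C complex"
  assumes \<mu>: "\<mu> \<in> states" and f: "\<And>x. f x \<in> \<real>\<^sub>\<ge>\<^sub>0"
  shows "\<mu> f \<in> \<real>\<^sub>\<ge>\<^sub>0"
proof -
  have "(\<lambda>x. complex_of_real (sqrt (Re (f x)))) \<in> bcontfun"
  proof (rule bcontfun_normI[where b = "sqrt (norm f)"])
    show "continuous_on UNIV (\<lambda>x. complex_of_real (sqrt (Re (f x))))"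
      by (intro continuous_intros) simp
    show "cmod (complex_of_real (sqrt (Re (f x)))) \<le> sqrt (norm f)" for x
      using f[of x] order_trans[OF complex_Re_le_cmod norm_bounded[of f x]]
      by (simp add: complex_nonneg_Reals_iff)
  qed
  then obtain k where k: "apply_bcontfun k = (\<lambda>x. complex_of_real (sqrt (Re (f x))))"
    by (metis bcontfunE)
  have "star k * k = f"
    using f by (intro bcontfun_eqI)
      (simp add: k star_complex_def complex_nonneg_Reals_iff complex_eq_iff flip: of_real_mult)
  then show ?thesis using statesD(3)[OF \<mu>, of k] by simp
qed

text \<open>
  States are contractive. It suffices to bound \<open>\<mu>\<close> on the real part of \<open>u h\<close>, where the
  scalar \<open>u\<close> rotates \<open>\<mu> h\<close> to its modulus, and there the bound is positivity of \<open>\<mu>\<close> on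
  \<open>e - Re (u h)\<close>. The constant \<open>e\<close> itself, rather than a multiple of it, is needed for the
  isometry of \<open>z \<mapsto> \<delta> z\<close>.
\<close>

lemma state_cmod_le:
  fixes h :: "'k::topological_space \<Rightarrow>\<^sub>C complex"
  assumes \<mu>: "\<mu> \<in> states" and h: "\<And>x. cmod (h x) \<le> e"
  shows "cmod (\<mu> h) \<le> e"
proof -
  define u where "u = cnj (sgn (\<mu> h))"
  have u: "cmod u \<le> 1" "u * \<mu> h = complex_of_real (cmod (\<mu> h))"
  proof -
    show "cmod u \<le> 1" by (simp add: u_def norm_sgn)
    show "u * \<mu> h = complex_of_real (cmod (\<mu> h))"
    proof (cases "\<mu> h = 0")
      case False
      then show ?thesis
        by (simp add: u_def sgn_eq field_simps complex_norm_square[symmetric] power2_eq_square)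
    qed simp
  qed
  have "cmod (u * h x) \<le> e" for x
    using mult_mono[OF u(1) h[of x]] by (simp add: norm_mult)
  then have Re_le: "Re (u * h x) \<le> e" for x
    using complex_Re_le_cmod order_trans by blast
  \<comment> \<open>\<open>?g\<close> is the function \<open>e - Re (u h)\<close>, written with the operations of the algebra so that
     \<open>\<mu>\<close> can be computed on it.\<close>
  let ?g = "complex_of_real e *\<^sub>C 1 - (1/2) *\<^sub>C (u *\<^sub>C h + star (u *\<^sub>C h))"
  have "?g x \<in> \<real>\<^sub>\<ge>\<^sub>0" for x
    using Re_le[of x]
    by (simp add: scaleC_complex_def star_complex_def complex_nonneg_Reals_iff)
  then have "\<mu> ?g \<in> \<real>\<^sub>\<ge>\<^sub>0" by (rule state_nonneg[OF \<mu>])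
  moreover have "\<mu> ?g = complex_of_real (e - cmod (\<mu> h))"
    by (simp add: state_diff[OF \<mu>] statesD[OF \<mu>] state_star[OF \<mu>] u(2) del: complex_cnj_mult)
  ultimately show ?thesis by (simp add: complex_nonneg_Reals_iff)
qed

lemma state_comp_pullback:
  assumes \<mu>: "\<mu> \<in> states" and G: "continuous_on UNIV G"
  shows "\<mu> \<circ> pullback G \<in> states"
  using unital_star_hom_pullback[OF G] \<mu>
  unfolding states_def unital_star_hom_def by auto

section \<open>Density of the elementary tensors\<close>

inductive_set tensor_sums :: "(('y::topological_space \<times> 'z::topological_space) \<Rightarrow>\<^sub>C complex) set" where
  elementary: "fun_tensor f g \<in> tensor_sums"
| add: "s \<in> tensor_sums \<Longrightarrow> t \<in> tensor_sums \<Longrightarrow> s + t \<in> tensor_sums"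

lemma tensor_sums_scaleC: "s \<in> tensor_sums \<Longrightarrow> x *\<^sub>C s \<in> tensor_sums"
proof (induction rule: tensor_sums.induct)
  case (elementary f g)
  have "x *\<^sub>C fun_tensor f g = fun_tensor (x *\<^sub>C f) g"
    by (rule bcontfun_eqI) (auto simp: scaleC_complex_def)
  then show ?case by (simp add: tensor_sums.elementary)
qed (simp add: scaleC_add_right tensor_sums.add)

lemma tensor_sums_mult: "s \<in> tensor_sums \<Longrightarrow> t \<in> tensor_sums \<Longrightarrow> s * t \<in> tensor_sums"
proof (induction arbitrary: t rule: tensor_sums.induct)
  case (elementary f g)
  from elementary show ?case
  proof (induction rule: tensor_sums.induct)
    case (elementary f' g')
    have "fun_tensor f g * fun_tensor f' g' = fun_tensor (f * f') (g * g')"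
      by (rule bcontfun_eqI) auto
    then show ?case by (simp add: tensor_sums.elementary)
  qed (simp add: distrib_left tensor_sums.add)
qed (simp add: distrib_right tensor_sums.add)

text \<open>
  A compact Hausdorff space is normal, so Urysohn's lemma separates points by a real function.
\<close>

lemma compact_Hausdorff_separating_bcontfun:
  fixes x x' :: "'k::t2_space"
  assumes K: "compact (UNIV :: 'k set)" and "x \<noteq> x'"
  obtains f :: "'k \<Rightarrow>\<^sub>C complex" where "\<And>w. f w \<in> \<real>" "f x \<noteq> f x'"
proof -
  have "Hausdorff_space (euclidean :: 'k topology)"
    unfolding Hausdorff_space_def disjnt_def by (simp, meson hausdorff)
  then have "normal_space (euclidean :: 'k topology)"
    by (intro compact_Hausdorff_or_regular_imp_normal_space)
      (use K in \<open>auto simp: compact_space_def\<close>)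
  then obtain g where g: "continuous_map euclidean (top_of_set {0..1::real}) g"
      "g ` {x} \<subseteq> {0}" "g ` {x'} \<subseteq> {1}"
    by (rule Urysohn_lemma[of euclidean "{x}" "{x'}" 0 1]) (use \<open>x \<noteq> x'\<close> in auto)
  have "continuous_on UNIV g" "\<And>w. g w \<in> {0..1}"
    using g(1) by (auto simp: continuous_map_in_subtopology)
  then have "(\<lambda>w. complex_of_real (g w)) \<in> bcontfun"
    by (intro bcontfun_normI[where b = 1] continuous_intros) auto
  then obtain f where "apply_bcontfun f = (\<lambda>w. complex_of_real (g w))"
    by (metis bcontfunE)
  then show thesis using g(2,3) by (intro that[of f]) auto
qed

text \<open>
  The real functions that are sums of elementary tensors form an algebra containing the constants.
  It separates the points of \<open>Y \<times> Z\<close>: points that differ in one coordinate are separated by a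
  function of that coordinate, tensored with the constant one. Hence Stone-Weierstrass applies.
\<close>

lemma tensor_sums_dense_real:
  fixes h :: "'y::t2_space \<times> 'z::t2_space \<Rightarrow> real"
  assumes Y: "compact (UNIV :: 'y set)" and Z: "compact (UNIV :: 'z set)"
    and h: "continuous_on UNIV h" and "e > 0"
  obtains s where "s \<in> tensor_sums" "\<And>p. cmod (complex_of_real (h p) - s p) < e"
proof -
  define R where "R = {r. \<exists>s\<in>tensor_sums. \<forall>p::'y\<times>'z. apply_bcontfun s p = complex_of_real (r p)}"
  interpret function_ring_on R UNIV
  proof
    show "compact (UNIV :: ('y \<times> 'z) set)"
      using compact_Times[OF Y Z] by simp
    show "continuous_on UNIV r" if "r \<in> R" for r
    proof -
      from that obtain s where "\<And>p. apply_bcontfun s p = complex_of_real (r p)"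
        by (auto simp: R_def)
      then have "r = (\<lambda>p. Re (apply_bcontfun s p))" by simp
      then show ?thesis by (auto intro!: continuous_intros)
    qed
    show "(\<lambda>p. r p + r' p) \<in> R" if "r \<in> R" "r' \<in> R" for r r'
    proof -
      from that obtain s s' where "s \<in> tensor_sums" "s' \<in> tensor_sums"
        "\<And>p. apply_bcontfun s p = complex_of_real (r p)"
        "\<And>p. apply_bcontfun s' p = complex_of_real (r' p)" by (auto simp: R_def)
      then show ?thesis by (auto simp: R_def intro!: bexI[of _ "s + s'"] tensor_sums.add)
    qed
    show "(\<lambda>p. r p * r' p) \<in> R" if "r \<in> R" "r' \<in> R" for r r'
    proof -
      from that obtain s s' where "s \<in> tensor_sums" "s' \<in> tensor_sums"
        "\<And>p. apply_bcontfun s p = complex_of_real (r p)"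
        "\<And>p. apply_bcontfun s' p = complex_of_real (r' p)" by (auto simp: R_def)
      then show ?thesis by (auto simp: R_def intro!: bexI[of _ "s * s'"] tensor_sums_mult)
    qed
    show "(\<lambda>_. c) \<in> R" for c
      by (auto simp: R_def scaleC_complex_def
          intro!: bexI[of _ "fun_tensor (complex_of_real c *\<^sub>C 1) 1"] tensor_sums.elementary)
    show "\<exists>r\<in>R. r p \<noteq> r q" if "p \<noteq> q" for p q
    proof -
      obtain y z y' z' where pq: "p = (y, z)" "q = (y', z')" by fastforce
      have in_R: "(\<lambda>p. Re (fun_tensor f g p)) \<in> R"
        if "\<And>w. f w \<in> \<real>" "\<And>w. g w \<in> \<real>"
        for f :: "'y \<Rightarrow>\<^sub>C complex" and g :: "'z \<Rightarrow>\<^sub>C complex"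
        using that by (auto simp: R_def complex_eq_iff complex_is_Real_iff
            intro!: bexI[of _ "fun_tensor f g"] tensor_sums.elementary)
      show ?thesis
      proof (cases "y = y'")
        case False
        then obtain f :: "'y \<Rightarrow>\<^sub>C complex" where "\<And>w. f w \<in> \<real>" "f y \<noteq> f y'"
          using compact_Hausdorff_separating_bcontfun[OF Y] by metis
        then show ?thesis using pq
          by (intro bexI[OF _ in_R[of f 1]]) (auto simp: complex_eq_iff complex_is_Real_iff)
      next
        case True
        then have "z \<noteq> z'" using \<open>p \<noteq> q\<close> pq by simp
        then obtain g :: "'z \<Rightarrow>\<^sub>C complex" where "\<And>w. g w \<in> \<real>" "g z \<noteq> g z'"
          using compact_Hausdorff_separating_bcontfun[OF Z] by metis
        then show ?thesis using pq
          by (intro bexI[OF _ in_R[of 1 g]]) (auto simp: complex_eq_iff complex_is_Real_iff)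
      qed
    qed
  qed
  obtain r where "r \<in> R" and r: "\<And>p. \<bar>h p - r p\<bar> < e"
    using Stone_Weierstrass_basic[OF h \<open>e > 0\<close>] by auto
  then obtain s where s: "s \<in> tensor_sums" "\<And>p. apply_bcontfun s p = complex_of_real (r p)"
    by (auto simp: R_def)
  show thesis
  proof
    show "cmod (complex_of_real (h p) - apply_bcontfun s p) < e" for p
      using r[of p] by (simp add: s(2) flip: of_real_diff)
  qed (rule s(1))
qed

lemma tensor_sums_dense:
  fixes h :: "('y::t2_space \<times> 'z::t2_space) \<Rightarrow>\<^sub>C complex"
  assumes Y: "compact (UNIV :: 'y set)" and Z: "compact (UNIV :: 'z set)" and "e > 0"
  obtains s where "s \<in> tensor_sums" "\<And>p. cmod (h p - s p) \<le> e"
proof -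
  have e: "e / 2 > 0" using \<open>e > 0\<close> by simp
  obtain s1 where s1: "s1 \<in> tensor_sums" "\<And>p. cmod (complex_of_real (Re (h p)) - s1 p) < e / 2"
    by (rule tensor_sums_dense_real[OF Y Z _ e, of "\<lambda>p. Re (h p)"])
      (auto intro!: continuous_intros)
  obtain s2 where s2: "s2 \<in> tensor_sums" "\<And>p. cmod (complex_of_real (Im (h p)) - s2 p) < e / 2"
    by (rule tensor_sums_dense_real[OF Y Z _ e, of "\<lambda>p. Im (h p)"])
      (auto intro!: continuous_intros)
  show thesis
  proof
    show "s1 + \<i> *\<^sub>C s2 \<in> tensor_sums"
      by (intro tensor_sums.add tensor_sums_scaleC s1 s2)
    fix p
    have "h p - (s1 + \<i> *\<^sub>C s2) p
        = (complex_of_real (Re (h p)) - s1 p) + \<i> * (complex_of_real (Im (h p)) - s2 p)"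
      by (subst complex_eq[of "h p"]) (simp add: scaleC_complex_def algebra_simps)
    also have "cmod \<dots> \<le> e / 2 + e / 2"
      using s1(2)[of p] s2(2)[of p] by (intro norm_triangle_mono) (auto simp: norm_mult)
    finally show "cmod (h p - (s1 + \<i> *\<^sub>C s2) p) \<le> e" by simp
  qed
qed

text \<open>
  Two contractive linear functionals that agree on a dense subspace are equal. This justifies the
  definite description in the definition of product states.
\<close>

lemma states_eq_if_eq_on_tensors:
  fixes \<omega> \<omega>' :: "(('y::t2_space \<times> 'z::t2_space) \<Rightarrow>\<^sub>C complex) \<Rightarrow> complex"
  assumes Y: "compact (UNIV :: 'y set)" and Z: "compact (UNIV :: 'z set)"
    and \<omega>: "\<omega> \<in> states" and \<omega>': "\<omega>' \<in> states"
    and eq: "\<And>f g. \<omega> (fun_tensor f g) = \<omega>' (fun_tensor f g)"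
  shows "\<omega> = \<omega>'"
proof
  fix h
  have sums: "\<omega> s = \<omega>' s" if "s \<in> tensor_sums" for s
    using that by (induction rule: tensor_sums.induct) (simp_all add: eq statesD(1)[OF \<omega>] statesD(1)[OF \<omega>'])
  have "dist (\<omega> h) (\<omega>' h) \<le> e" if "e > 0" for e
  proof -
    obtain s where s: "s \<in> tensor_sums" "\<And>p. cmod (h p - s p) \<le> e / 2"
      by (rule tensor_sums_dense[OF Y Z half_gt_zero[OF \<open>e > 0\<close>], of h]) blast
    have "cmod (\<omega> (h - s)) \<le> e / 2" "cmod (\<omega>' (h - s)) \<le> e / 2"
      by (rule state_cmod_le[OF \<omega>] state_cmod_le[OF \<omega>'], use s(2) in simp)+
    moreover have "\<omega> h - \<omega>' h = \<omega> (h - s) - \<omega>' (h - s)"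
      by (simp add: state_diff[OF \<omega>] state_diff[OF \<omega>'] sums[OF s(1)])
    ultimately show ?thesis
      using norm_triangle_ineq4[of "\<omega> (h - s)" "\<omega>' (h - s)"] by (simp add: dist_norm)
  qed
  then show "\<omega> h = \<omega>' h"
    by (metis dist_le_zero_iff dense_le_bounded field_le_epsilon add_0)
qed

section \<open>Product states with a point mass\<close>

lemma product_state_eqI:
  fixes \<omega> :: "(('y::t2_space \<times> 'z::t2_space) \<Rightarrow>\<^sub>C complex) \<Rightarrow> complex"
  assumes "compact (UNIV :: 'y set)" "compact (UNIV :: 'z set)"
    and "\<omega> \<in> states" "\<And>f g. \<omega> (fun_tensor f g) = \<mu> f * \<nu> g"
  shows "product_state fun_tensor \<mu> \<nu> = \<omega>"
  unfolding product_state_def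
  using assms by (intro the_equality) (auto intro: states_eq_if_eq_on_tensors)

lemma product_state_point_eval_right:
  fixes \<mu> :: "('y::t2_space \<Rightarrow>\<^sub>C complex) \<Rightarrow> complex" and z :: "'z::t2_space"
  assumes Y: "compact (UNIV :: 'y set)" and Z: "compact (UNIV :: 'z set)" and \<mu>: "\<mu> \<in> states"
  shows "product_state fun_tensor \<mu> (\<delta> z) = \<mu> \<circ> pullback (\<lambda>y. (y, z))"
proof (rule product_state_eqI[OF Y Z])
  have cont: "continuous_on UNIV (\<lambda>y::'y. (y, z))" by (intro continuous_intros)
  show "\<mu> \<circ> pullback (\<lambda>y. (y, z)) \<in> states" by (rule state_comp_pullback[OF \<mu> cont])
  fix f :: "'y \<Rightarrow>\<^sub>C complex" and g
  have "pullback (\<lambda>y. (y, z)) (fun_tensor f g) = g z *\<^sub>C f"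
    by (rule bcontfun_eqI) (simp add: apply_pullback[OF cont] scaleC_complex_def)
  then show "(\<mu> \<circ> pullback (\<lambda>y. (y, z))) (fun_tensor f g) = \<mu> f * \<delta> z g"
    by (simp add: statesD[OF \<mu>] point_eval_def)
qed

lemma product_state_point_eval_left:
  fixes \<nu> :: "('z::t2_space \<Rightarrow>\<^sub>C complex) \<Rightarrow> complex" and y :: "'y::t2_space"
  assumes Y: "compact (UNIV :: 'y set)" and Z: "compact (UNIV :: 'z set)" and \<nu>: "\<nu> \<in> states"
  shows "product_state fun_tensor (\<delta> y) \<nu> = \<nu> \<circ> pullback (\<lambda>z. (y, z))"
proof (rule product_state_eqI[OF Y Z])
  have cont: "continuous_on UNIV (\<lambda>z::'z. (y, z))" by (intro continuous_intros)
  show "\<nu> \<circ> pullback (\<lambda>z. (y, z)) \<in> states" by (rule state_comp_pullback[OF \<nu> cont])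
  fix f and g :: "'z \<Rightarrow>\<^sub>C complex"
  have "pullback (\<lambda>z. (y, z)) (fun_tensor f g) = f y *\<^sub>C g"
    by (rule bcontfun_eqI) (simp add: apply_pullback[OF cont] scaleC_complex_def)
  then show "(\<nu> \<circ> pullback (\<lambda>z. (y, z))) (fun_tensor f g) = \<delta> y f * \<nu> g"
    by (simp add: statesD[OF \<nu>] point_eval_def)
qed

section \<open>The induced pseudo-metric\<close>

lemma continuous_on_slices:
  fixes F :: "'y::topological_space \<times> 'z::topological_space \<Rightarrow> 'x::topological_space"
  assumes "continuous_on UNIV F"
  shows "continuous_on UNIV (\<lambda>y. F (y, z))" "continuous_on UNIV (\<lambda>z. F (y, z))"
  by (rule continuous_on_compose2[OF assms]; auto intro!: continuous_intros)+

text \<open>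
  The difference on the left is the difference of the two product states with \<open>\<delta> y\<close>,
  evaluated on \<open>a \<circ> F\<close>; it is therefore one of the quantities whose supremum is the induced
  pseudo-metric. This is the source of elements of the induced space with seminorm at most one.
\<close>

lemma cmod_diff_slice_le_induced_pseudo_metric:
  fixes F :: "'y::t2_space \<times> 'z::t2_space \<Rightarrow> 'x::topological_space"
  assumes Y: "compact (UNIV :: 'y set)" and Z: "compact (UNIV :: 'z set)"
    and F: "continuous_on UNIV F"
    and a: "a \<in> A" "L a \<le> 1" and \<nu>: "\<nu> \<in> states" "\<nu>' \<in> states"
  shows "ennreal (cmod (\<nu> (pullback (\<lambda>z. F (y, z)) a) - \<nu>' (pullback (\<lambda>z. F (y, z)) a)))
    \<le> induced_pseudo_metric fun_tensor (A, L) (pullback F) \<nu> \<nu>'"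
proof -
  let ?\<omega> = "\<lambda>\<nu>. product_state fun_tensor (\<delta> y) \<nu> \<circ> pullback F"
  have cont: "continuous_on UNIV (\<lambda>z::'z. (y, z))" by (intro continuous_intros)
  have "pullback (\<lambda>z. (y, z)) (pullback F a) = pullback (\<lambda>z. F (y, z)) a"
    by (rule bcontfun_eqI)
      (simp add: apply_pullback[OF cont] apply_pullback[OF F] apply_pullback[OF continuous_on_slices(2)[OF F]])
  then have "?\<omega> \<nu> a = \<nu> (pullback (\<lambda>z. F (y, z)) a)" if "\<nu> \<in> states" for \<nu>
    by (simp add: product_state_point_eval_left[OF Y Z that])
  then have "ennreal (cmod (\<nu> (pullback (\<lambda>z. F (y, z)) a) - \<nu>' (pullback (\<lambda>z. F (y, z)) a)))
      = ennreal (cmod (?\<omega> \<nu> a - ?\<omega> \<nu>' a))" using \<nu> by simp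
  also have "\<dots> \<le> rho A L (?\<omega> \<nu>) (?\<omega> \<nu>')"
    unfolding rho_def using a by (intro Sup_upper) blast
  also have "\<dots> \<le> induced_pseudo_metric fun_tensor (A, L) (pullback F) \<nu> \<nu>'"
    unfolding induced_pseudo_metric_def prod.case by (rule SUP_upper[OF point_eval_in_states])
  finally show ?thesis .
qed

text \<open>
  The point evaluations embed \<open>Z\<close> isometrically into the states. For an upper bound, the
  functions \<open>a (F (y, z))\<close> and \<open>a (F (y, z'))\<close> of \<open>y\<close> differ uniformly by at most the
  right-hand side when \<open>a\<close> has seminorm at most one, and \<open>\<mu>\<close> is contractive. For a lower
  bound, point masses \<open>\<mu>\<close> suffice.
\<close>

lemma induced_pseudo_metric_point_eval:
  fixes d0 :: "'x::topological_space \<Rightarrow> 'x \<Rightarrow> ennreal"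
    and F :: "'y::t2_space \<times> 'z::t2_space \<Rightarrow> 'x"
  assumes X: "compact (UNIV :: 'x set)" and Y: "compact (UNIV :: 'y set)"
    and Z: "compact (UNIV :: 'z set)"
    and d0: "pseudo_metric_on UNIV d0"
    and weaker: "\<And>U. openin (pseudo_metric_topology UNIV d0) U \<Longrightarrow> open U"
    and F: "continuous_on UNIV F"
  shows "induced_pseudo_metric fun_tensor (Lip_QSM_space d0) (pullback F) (\<delta> z) (\<delta> z')
    = (SUP y. d0 (F (y, z)) (F (y, z')))"
proof -
  obtain A L where AL: "(A, L) = Lip_QSM_space d0" by (metis surj_pair)
  define d1 where "d1 = (SUP y. d0 (F (y, z)) (F (y, z')))"
  note slice = apply_pullback[OF continuous_on_slices(1)[OF F]]
  have rho_d0: "rho A L (\<delta> x) (\<delta> x') = d0 x x'" for x x'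
    by (rule rho_Lip_point_eval[OF X d0 weaker AL])
  have "induced_pseudo_metric fun_tensor (A, L) (pullback F) (\<delta> z) (\<delta> z') = d1"
  proof (rule antisym)
    show "induced_pseudo_metric fun_tensor (A, L) (pullback F) (\<delta> z) (\<delta> z') \<le> d1"
      unfolding induced_pseudo_metric_def prod.case
    proof (rule SUP_least)
      fix \<mu> :: "('y \<Rightarrow>\<^sub>C complex) \<Rightarrow> complex" assume \<mu>: "\<mu> \<in> states"
      let ?\<omega> = "\<lambda>z. product_state fun_tensor \<mu> (\<delta> z) \<circ> pullback F"
      have \<omega>: "?\<omega> w a = \<mu> (pullback (\<lambda>y. F (y, w)) a)" for w :: 'z and a
      proof -
        have cont: "continuous_on UNIV (\<lambda>y::'y. (y, w))" by (intro continuous_intros)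
        have "pullback (\<lambda>y. (y, w)) (pullback F a) = pullback (\<lambda>y. F (y, w)) a"
          by (rule bcontfun_eqI) (simp add: apply_pullback[OF cont] apply_pullback[OF F] slice)
        then show ?thesis by (simp add: product_state_point_eval_right[OF Y Z \<mu>])
      qed
      have "ennreal (cmod (?\<omega> z a - ?\<omega> z' a)) \<le> d1" if a: "a \<in> A" "L a \<le> 1" for a
      proof (cases d1)
        \<comment> \<open>If \<open>d1\<close> is infinite there is nothing to show; a real bound is needed to apply contractivity.\<close>
        case (real r)
        have "cmod (a (F (y, z)) - a (F (y, z'))) \<le> r" for y
        proof -
          have "ennreal (cmod (\<delta> (F (y, z)) a - \<delta> (F (y, z')) a)) \<le> rho A L (\<delta> (F (y, z))) (\<delta> (F (y, z')))"
            unfolding rho_def using a by (intro Sup_upper) blast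
          also have "\<dots> \<le> d1" unfolding rho_d0 d1_def by (rule SUP_upper) simp
          finally show ?thesis using real by (simp add: point_eval_def)
        qed
        then have "cmod (\<mu> (pullback (\<lambda>y. F (y, z)) a - pullback (\<lambda>y. F (y, z')) a)) \<le> r"
          by (intro state_cmod_le[OF \<mu>]) (simp add: slice)
        then show ?thesis using real unfolding \<omega> by (simp add: state_diff[OF \<mu>] ennreal_leI)
      qed simp
      then show "rho A L (?\<omega> z) (?\<omega> z') \<le> d1"
        unfolding rho_def by (auto intro!: Sup_least)
    qed
    show "d1 \<le> induced_pseudo_metric fun_tensor (A, L) (pullback F) (\<delta> z) (\<delta> z')"
      unfolding d1_def
    proof (rule SUP_least)
      fix y
      have "rho A L (\<delta> (F (y, z))) (\<delta> (F (y, z')))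
          \<le> induced_pseudo_metric fun_tensor (A, L) (pullback F) (\<delta> z) (\<delta> z')"
        unfolding rho_def
      proof (rule Sup_least, clarify)
        fix a assume "a \<in> A" "L a \<le> 1"
        from cmod_diff_slice_le_induced_pseudo_metric[where y = y and L = L, OF Y Z F this
            point_eval_in_states[of z] point_eval_in_states[of z']]
        show "ennreal (cmod (\<delta> (F (y, z)) a - \<delta> (F (y, z')) a))
            \<le> induced_pseudo_metric fun_tensor (A, L) (pullback F) (\<delta> z) (\<delta> z')"
          by (simp add: point_eval_def apply_pullback[OF continuous_on_slices(2)[OF F]])
      qed
      then show "d0 (F (y, z)) (F (y, z'))
          \<le> induced_pseudo_metric fun_tensor (A, L) (pullback F) (\<delta> z) (\<delta> z')"
        by (simp add: rho_d0)
    qed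
  qed
  then show ?thesis by (simp add: AL d1_def)
qed

section \<open>Point evaluations in the induced quantum space\<close>

theorem theorem4p2:
  fixes d0 :: "'x::t2_space \<Rightarrow> 'x \<Rightarrow> ennreal"
    and F :: "'y::t2_space \<times> 'z::t2_space \<Rightarrow> 'x"
    and d1 :: "'z \<Rightarrow> 'z \<Rightarrow> ennreal"
    and C :: "('z \<Rightarrow>\<^sub>C complex) set"
    and N :: "('z \<Rightarrow>\<^sub>C complex) \<Rightarrow> ennreal"
  assumes "compact (UNIV :: 'x set)" and "compact (UNIV :: 'y set)" and "compact (UNIV :: 'z set)"
    and "pseudo_metric_on UNIV d0"
    and "\<And>U. openin (pseudo_metric_topology UNIV d0) U \<Longrightarrow> open U"
    and "continuous_on UNIV F"
    and "\<And>z z'. d1 z z' = (SUP y. d0 (F (y, z)) (F (y, z')))"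
    and "(C, N) = induced_QSM_space fun_tensor (Lip_QSM_space d0) (pullback F)"
  shows "(\<forall>z z'. d1 z z' = rho C N (\<delta> z) (\<delta> z')) \<and>
    apply_bcontfun ` C \<subseteq> Lip UNIV d1 \<and>
    (\<forall>c\<in>C. lip_seminorm UNIV d1 (apply_bcontfun c) \<le> N c)"
proof -
  define d where "d = induced_pseudo_metric fun_tensor (Lip_QSM_space d0) (pullback F)"
  have N: "N = state_lip_seminorm d"
    and C: "c \<in> C \<longleftrightarrow> continuous_map (pseudo_metric_topology states d) euclidean (\<lambda>\<nu>. \<nu> c) \<and>
      state_lip_seminorm d c < top" for c
    using assms(8) by (auto simp: induced_QSM_space_def Let_def d_def)
  have d_delta: "d (\<delta> z) (\<delta> z') = d1 z z'" for z z'
    unfolding d_def assms(7) by (rule induced_pseudo_metric_point_eval[OF assms(1-6)])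
  obtain A L where AL: "(A, L) = Lip_QSM_space d0" by (metis surj_pair)

  \<comment> \<open>Restricting the supremum over pairs of states to pairs of point masses.\<close>
  have le: "lip_seminorm UNIV d1 (apply_bcontfun c) \<le> N c" for c
    unfolding N state_lip_seminorm_def lip_seminorm_def
  proof (rule Sup_subset_mono, clarify)
    fix z z' assume "d1 z z' \<noteq> 0"
    then show "\<exists>\<nu> \<nu>'. ennreal (cmod (c z - c z')) / d1 z z' = ennreal (cmod (\<nu> c - \<nu>' c)) / d \<nu> \<nu>' \<and>
        \<nu> \<in> states \<and> \<nu>' \<in> states \<and> d \<nu> \<nu>' \<noteq> 0"
      by (intro exI[of _ "\<delta> z"] exI[of _ "\<delta> z'"])
        (simp add: d_delta point_eval_in_states, simp add: point_eval_def)
  qed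

  have "apply_bcontfun c \<in> Lip UNIV d1" if "c \<in> C" for c
  proof -
    have "continuous_map (pseudo_metric_topology UNIV d1) (pseudo_metric_topology states d) \<delta>"
      unfolding continuous_map_def openin_pseudo_metric_topology
      by (auto simp: point_eval_in_states d_delta)
        (metis d_delta point_eval_in_states)
    then have "continuous_map (pseudo_metric_topology UNIV d1) euclidean ((\<lambda>\<nu>. \<nu> c) \<circ> \<delta>)"
      using that C by (blast intro: continuous_map_compose)
    moreover have "(\<lambda>\<nu>. \<nu> c) \<circ> \<delta> = apply_bcontfun c"
      by (auto simp: point_eval_def)
    moreover have "bounded (range (apply_bcontfun c))" by simp
    moreover have "lip_seminorm UNIV d1 (apply_bcontfun c) < top"
      using le[of c] that C N by (auto intro: le_less_trans)
    ultimately show ?thesis by (simp add: Lip_def)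
  qed
  moreover have "d1 z z' = rho C N (\<delta> z) (\<delta> z')" for z z'
  proof (rule antisym)
    show "rho C N (\<delta> z) (\<delta> z') \<le> d1 z z'"
      unfolding rho_def
    proof (rule Sup_least, clarify)
      fix c assume "c \<in> C" "N c \<le> 1"
      then show "ennreal (cmod (\<delta> z c - \<delta> z' c)) \<le> d1 z z'"
        unfolding d_delta[symmetric] N state_lip_seminorm_def
        by (intro cmod_diff_le_of_lip_seminorm_le_1[where f = "\<lambda>\<nu>. \<nu> c" and S = states])
          (auto simp: C point_eval_in_states)
    qed
    show "d1 z z' \<le> rho C N (\<delta> z) (\<delta> z')"
      unfolding assms(7)
    proof (rule SUP_least)
      fix y
      have "rho A L (\<delta> (F (y, z))) (\<delta> (F (y, z'))) \<le> rho C N (\<delta> z) (\<delta> z')"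
        unfolding rho_def[of A]
      proof (rule Sup_least, clarify)
        fix a assume a: "a \<in> A" "L a \<le> 1"
        \<comment> \<open>The slice at \<open>y\<close> is the witness: it lies in \<open>C\<close>, and at \<open>z\<close> it has the value \<open>a (F (y, z))\<close>.\<close>
        define c where "c = pullback (\<lambda>z. F (y, z)) a"
        have lip: "ennreal (cmod (\<nu> c - \<nu>' c)) \<le> d \<nu> \<nu>'" if "\<nu> \<in> states" "\<nu>' \<in> states" for \<nu> \<nu>'
          unfolding c_def d_def AL[symmetric]
          by (rule cmod_diff_slice_le_induced_pseudo_metric[where A = A and L = L, OF assms(2,3,6) a that])
        have "N c \<le> 1"
          unfolding N state_lip_seminorm_def by (rule lip_seminorm_le_1I) (rule lip)
        moreover from this have "state_lip_seminorm d c < top"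
          unfolding N by (rule le_less_trans) simp
        then have "c \<in> C"
          unfolding C by (intro conjI continuous_map_pseudo_metricI lip)
        ultimately have "ennreal (cmod (\<delta> z c - \<delta> z' c)) \<le> rho C N (\<delta> z) (\<delta> z')"
          unfolding rho_def by (intro Sup_upper) blast
        then show "ennreal (cmod (\<delta> (F (y, z)) a - \<delta> (F (y, z')) a)) \<le> rho C N (\<delta> z) (\<delta> z')"
          by (simp add: point_eval_def c_def apply_pullback[OF continuous_on_slices(2)[OF assms(6)]])
      qed
      then show "d0 (F (y, z)) (F (y, z')) \<le> rho C N (\<delta> z) (\<delta> z')"
        by (simp add: rho_Lip_point_eval[OF assms(1,4,5) AL])
    qed
  qed
  ultimately show ?thesis using le by blast
qed

end
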